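(* Let $L$ be a decomposable lattice. The following conditions are equivalent: (1) $V(L)=S(L)$, i.e. every regular ideal of $L$ is special. (2) The lattice $Ide(L)$ is completely distributive. (3) The lattice $Ide(L)$ is dually $\alpha$-distributive for every cardinal $\alpha$, i.e. for every $I\in Ide(L)$ and every nonempty family $\{J_{\lambda}\}_{\lambda\in\Lambda}\subseteq Ide(L)$, $I\vee\bigl(\bigcap_{\lambda\in\Lambda}J_{\lambda}\bigr)=\bigcap_{\lambda\in\Lambda}(I\vee J_{\lambda})$.
   Context: A decomposable lattice is a distributive lattice $L$ with minimum element $0$ such that for any $a,b\in L$ that are not comparable there exist $\overline{a},\overline{b}\in L$ with $a=\overline{a}\vee(a\wedge b)$, $b=\overline{b}\vee(a\wedge b)$ and $\overline{a}\wedge\overline{b}=0$. An ideal of $L$ is a nonempty subset closed under $\vee$ and downward closed. $Ide(L)$ is the lattice of all ideals of $L$ under inclusion, with meet given by intersection and $I\vee J=\{a\vee b\mid a\in I,\ b\in J\}$. For $0<x\in L$, a value of $x$ is an ideal maximal among the ideals not containing $x$. $V(L)$ is the set of all ideals that are values of some $0<x\in L$ (regular ideals); $S(L)$ is the set of all ideals $M$ such that $M$ is the unique value of some $0<x\in L$ (special ideals). A lattice $D$ is completely distributive if for every nonempty family $\{a_{i,j}\}_{i\in I,j\in J}\subseteq D$, whenever $\bigvee_{i\in I}\bigwedge_{j\in J}a_{i,j}$ and $\bigwedge_{f\in J^{I}}\bigvee_{i\in I}a_{i,f(i)}$ exist in $D$, they are equal, where $J^{I}$ is the set of all maps $I\to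 J$. *)

theory Defs
  imports Main "HOL-Library.FuncSet" "HOL-Library.Lub_Glb"
begin

class decomposable_lattice = distrib_lattice + bounded_lattice_bot +
  assumes decomposition:
    "\<not> a \<le> b \<Longrightarrow> \<not> b \<le> a \<Longrightarrow>
      \<exists>a' b'. a = sup a' (inf a b) \<and> b = sup b' (inf a b) \<and> inf a' b' = bot"

definition is_ideal :: "'a::decomposable_lattice set \<Rightarrow> bool" where
  "is_ideal I \<longleftrightarrow>
     I \<noteq> {} \<and> (\<forall>a\<in>I. \<forall>b\<in>I. sup a b \<in> I) \<and> (\<forall>a\<in>I. \<forall>b. b \<le> a \<longrightarrow> b \<in> I)"

lemma is_ideal_bot: "is_ideal I \<Longrightarrow> bot \<in> I"
  unfolding is_ideal_def by (metis ex_in_conv bot_least)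

lemma is_ideal_sup_closed: "is_ideal I \<Longrightarrow> a \<in> I \<Longrightarrow> b \<in> I \<Longrightarrow> sup a b \<in> I"
  unfolding is_ideal_def by blast

lemma is_ideal_sup:
  assumes "is_ideal I" "is_ideal J"
  shows "is_ideal {sup a b | a b. a \<in> I \<and> b \<in> J}"
  unfolding is_ideal_def
proof (intro conjI ballI allI impI)
  show "{sup a b | a b. a \<in> I \<and> b \<in> J} \<noteq> {}"
    using assms is_ideal_bot by blast
next
  fix x y
  assume "x \<in> {sup a b | a b. a \<in> I \<and> b \<in> J}" "y \<in> {sup a b | a b. a \<in> I \<and> b \<in> J}"
  then obtain a b c d where *: "x = sup a b" "y = sup c d" "a \<in> I" "b \<in> J" "c \<in> I" "d \<in> J"
    by blast
  have "sup x y = sup (sup a c) (sup b d)"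
    using * by (simp add: ac_simps)
  moreover have "sup a c \<in> I" "sup b d \<in> J"
    using * assms by (auto simp: is_ideal_def)
  ultimately show "sup x y \<in> {sup a b | a b. a \<in> I \<and> b \<in> J}" by blast
next
  fix x y
  assume "x \<in> {sup a b | a b. a \<in> I \<and> b \<in> J}" and le: "y \<le> x"
  then obtain a b where *: "x = sup a b" "a \<in> I" "b \<in> J" by blast
  have "y = sup (inf y a) (inf y b)"
    using le * by (metis inf.absorb1 inf_sup_distrib1)
  moreover have "inf y a \<in> I" "inf y b \<in> J"
    using * assms unfolding is_ideal_def by (meson inf_le2)+
  ultimately show "y \<in> {sup a b | a b. a \<in> I \<and> b \<in> J}" by blast
qed

typedef (overloaded) ('a::decomposable_lattice) ideal = "{I :: 'a set. is_ideal I}"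
  morphisms elements Abs_ideal
  by (rule exI[of _ UNIV]) (simp add: is_ideal_def)

setup_lifting type_definition_ideal

instantiation ideal :: (decomposable_lattice) complete_lattice
begin

lift_definition less_eq_ideal :: "'a ideal \<Rightarrow> 'a ideal \<Rightarrow> bool" is "(\<subseteq>)" .

lift_definition less_ideal :: "'a ideal \<Rightarrow> 'a ideal \<Rightarrow> bool" is "(\<subset>)" .

lift_definition inf_ideal :: "'a ideal \<Rightarrow> 'a ideal \<Rightarrow> 'a ideal" is "(\<inter>)"
proof -
  fix I J :: "'a set" assume *: "is_ideal I" "is_ideal J"
  then have "bot \<in> I \<inter> J" using is_ideal_bot by blast
  then show "is_ideal (I \<inter> J)" using * unfolding is_ideal_def
    by (intro conjI ballI allI impI) auto
qed

lift_definition sup_ideal :: "'a ideal \<Rightarrow> 'a ideal \<Rightarrow> 'a ideal"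
  is "\<lambda>I J. {sup a b | a b. a \<in> I \<and> b \<in> J}"
  by (rule is_ideal_sup)

lift_definition bot_ideal :: "'a ideal" is "{bot}"
  by (simp add: is_ideal_def bot_unique)

lift_definition top_ideal :: "'a ideal" is UNIV
  by (simp add: is_ideal_def)

lift_definition Inf_ideal :: "'a ideal set \<Rightarrow> 'a ideal" is "\<lambda>F. \<Inter>F"
proof -
  fix F :: "'a set set" assume F: "\<And>I. I \<in> F \<Longrightarrow> is_ideal I"
  have "bot \<in> \<Inter>F" using F is_ideal_bot by blast
  then show "is_ideal (\<Inter>F)"
    using F unfolding is_ideal_def by (intro conjI ballI allI impI) auto
qed

definition Sup_ideal :: "'a ideal set \<Rightarrow> 'a ideal" where
  "Sup_ideal F = Inf {K. \<forall>I\<in>F. I \<le> K}"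

instance
proof
  fix I J K :: "'a ideal" and F :: "'a ideal set"
  show "(I < J) = (I \<le> J \<and> \<not> J \<le> I)" by transfer blast
  show "I \<le> I" by transfer blast
  show "I \<le> J \<Longrightarrow> J \<le> K \<Longrightarrow> I \<le> K" by transfer blast
  show "I \<le> J \<Longrightarrow> J \<le> I \<Longrightarrow> I = J" by transfer blast
  show "inf I J \<le> I" by transfer blast
  show "inf I J \<le> J" by transfer blast
  show "I \<le> J \<Longrightarrow> I \<le> K \<Longrightarrow> I \<le> inf J K" by transfer blast
  show "I \<le> sup I J"
    by transfer (use is_ideal_bot sup_bot_right in \<open>metis (mono_tags, lifting) mem_Collect_eq subsetI\<close>)
  show "J \<le> sup I J"
    by transfer (use is_ideal_bot sup_bot_left in \<open>metis (mono_tags, lifting) mem_Collect_eq subsetI\<close>)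
  show "J \<le> I \<Longrightarrow> K \<le> I \<Longrightarrow> sup J K \<le> I"
    by transfer (use is_ideal_sup_closed in blast)
  have Inf_lower: "I \<in> F \<Longrightarrow> Inf F \<le> I" for I :: "'a ideal" and F
    by transfer blast
  have Inf_greatest: "(\<And>I. I \<in> F \<Longrightarrow> K \<le> I) \<Longrightarrow> K \<le> Inf F" for K :: "'a ideal" and F
    by transfer blast
  show "I \<in> F \<Longrightarrow> Inf F \<le> I" by (rule Inf_lower)
  show "(\<And>I. I \<in> F \<Longrightarrow> K \<le> I) \<Longrightarrow> K \<le> Inf F" by (rule Inf_greatest)
  show "I \<in> F \<Longrightarrow> I \<le> Sup F"
    unfolding Sup_ideal_def by (rule Inf_greatest) blast
  show "(\<And>I. I \<in> F \<Longrightarrow> I \<le> K) \<Longrightarrow> Sup F \<le> K"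
    unfolding Sup_ideal_def by (rule Inf_lower) blast
  show "Inf {} = (top :: 'a ideal)" by transfer simp
  have "elements (Inf UNIV :: 'a ideal) = elements bot"
  proof
    show "elements (Inf UNIV :: 'a ideal) \<subseteq> elements bot"
    proof -
      have "Inf UNIV \<le> (bot :: 'a ideal)" by (rule Inf_lower) simp
      then show ?thesis by transfer
    qed
    show "elements (bot :: 'a ideal) \<subseteq> elements (Inf UNIV)" by transfer (auto simp: is_ideal_bot)
  qed
  then show "Sup {} = (bot :: 'a ideal)"
    by (simp add: Sup_ideal_def elements_inject)
qed

end

definition is_value :: "'a::decomposable_lattice ideal \<Rightarrow> 'a \<Rightarrow> bool" where
  "is_value M x \<longleftrightarrow>
     x \<notin> elements M \<and> (\<forall>N. x \<notin> elements N \<longrightarrow> M \<le> N \<longrightarrow> N = M)"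

definition regular_ideals :: "'a::decomposable_lattice ideal set" where
  "regular_ideals = {M. \<exists>x. bot < x \<and> is_value M x}"

definition special_ideals :: "'a::decomposable_lattice ideal set" where
  "special_ideals = {M. \<exists>x. bot < x \<and> is_value M x \<and> (\<forall>N. is_value N x \<longrightarrow> N = M)}"

text \<open>
  The distributivity condition for one family, subject to the existence of all joins and meets
  that occur: \<open>m i\<close> is the meet of row \<open>i\<close>, \<open>u\<close> the join of these meets, \<open>s f\<close> the join along
  the choice function \<open>f\<close>, and \<open>v\<close> the meet of these joins.
\<close>

definition family_distributes ::
  "'i set \<Rightarrow> 'j set \<Rightarrow> ('i \<Rightarrow> 'j \<Rightarrow> 'd::lattice) \<Rightarrow> bool" where
  "family_distributes I J a \<longleftrightarrow>
     (\<forall>m u s v.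
        (\<forall>i\<in>I. isGlb UNIV (a i ` J) (m i)) \<longrightarrow>
        isLub UNIV (m ` I) u \<longrightarrow>
        (\<forall>f \<in> I \<rightarrow>\<^sub>E J. isLub UNIV ((\<lambda>i. a i (f i)) ` I) (s f)) \<longrightarrow>
        isGlb UNIV (s ` (I \<rightarrow>\<^sub>E J)) v \<longrightarrow>
        u = v)"

text \<open>
  A definition in HOL cannot quantify over all index types. Row indices of type \<open>'d set\<close> and
  column indices of type \<open>'d\<close> are enough: lemma \<open>completely_distributive_family\<close> below gives
  the condition for families indexed by nonempty subsets of arbitrary types.
\<close>

definition completely_distributive :: "'d::lattice itself \<Rightarrow> bool" where
  "completely_distributive _ \<longleftrightarrow>
     (\<forall>(I :: 'd set set) (J :: 'd set) (a :: 'd set \<Rightarrow> 'd \<Rightarrow> 'd).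
        I \<noteq> {} \<longrightarrow> J \<noteq> {} \<longrightarrow> family_distributes I J a)"

lemma completely_distributive_family:
  fixes a :: "'i \<Rightarrow> 'j \<Rightarrow> 'd::lattice"
  assumes cd: "completely_distributive TYPE('d)" and ne: "I \<noteq> {}" "J \<noteq> {}"
  shows "family_distributes I J a"
  unfolding family_distributes_def
proof (intro allI impI)
  fix m u s v
  assume m: "\<forall>i\<in>I. isGlb UNIV (a i ` J) (m i)"
    and u: "isLub UNIV (m ` I) u"
    and s: "\<forall>f \<in> I \<rightarrow>\<^sub>E J. isLub UNIV ((\<lambda>i. a i (f i)) ` I) (s f)"
    and v: "isGlb UNIV (s ` (I \<rightarrow>\<^sub>E J)) v"
  define R where "R i = a i ` J" for i
  define I' where "I' = R ` I"
  define c where "c A d = (if d \<in> A then d else SOME x. x \<in> A)" for A and d :: 'd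
  define r where "r A = (SOME i. i \<in> I \<and> R i = A)" for A
  define F where "F f' = (\<lambda>i\<in>I. SOME j. j \<in> J \<and> a i j = c (R i) (f' (R i)))"
    for f' :: "'d set \<Rightarrow> 'd"
  have c_in: "c A d \<in> A" if "A \<noteq> {}" for A d
    using that by (auto simp: c_def intro: someI)
  have R_ne: "R i \<noteq> {}" for i using ne by (simp add: R_def)
  have c_img: "range (c A) = A" if "A \<noteq> {}" for A
  proof
    show "range (c A) \<subseteq> A" using c_in[OF that] by blast
    show "A \<subseteq> range (c A)"
    proof
      fix d assume "d \<in> A"
      then have "c A d = d" by (simp add: c_def)
      then show "d \<in> range (c A)" by (metis rangeI)
    qed
  qed
  have r: "r A \<in> I" "R (r A) = A" if "A \<in> I'" for A
    using someI_ex[of "\<lambda>i. i \<in> I \<and> R i = A"] that by (auto simp: I'_def r_def)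
  have F: "F f' i \<in> J \<and> a i (F f' i) = c (R i) (f' (R i))" if "i \<in> I" for f' i
  proof -
    have "\<exists>j. j \<in> J \<and> a i j = c (R i) (f' (R i))"
      using c_in[OF R_ne[of i], of "f' (R i)"] by (force simp: R_def)
    from someI_ex[OF this] show ?thesis using that by (simp add: F_def)
  qed
  have F_Pi: "F f' \<in> I \<rightarrow>\<^sub>E J" for f'
    using F by (auto simp: F_def PiE_def extensional_def)
  have F_img: "(\<lambda>i. a i (F f' i)) ` I = (\<lambda>A. c A (f' A)) ` I'" for f'
    unfolding I'_def image_image using F by (intro image_cong) auto
  have m': "isGlb UNIV (range (c A)) (m (r A))" if "A \<in> I'" for A
  proof -
    have "A \<noteq> {}" using that R_ne by (auto simp: I'_def)
    then have "range (c A) = a (r A) ` J"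
      using c_img r[OF that] by (simp add: R_def)
    then show ?thesis using m r[OF that] by simp
  qed
  have meets_eq: "m i = m (r (R i))" if "i \<in> I" for i
  proof -
    have "R i \<in> I'" using that by (simp add: I'_def)
    then have *: "r (R i) \<in> I" "a (r (R i)) ` J = a i ` J"
      using r[of "R i"] by (auto simp: R_def)
    have "isGlb UNIV (a i ` J) (m i)" "isGlb UNIV (a i ` J) (m (r (R i)))"
      using m that * by force+
    then show ?thesis
      by (meson isGlb_isLb isGlb_le_isLb order_antisym)
  qed
  have "(\<lambda>A. m (r A)) ` I' = m ` I"
    unfolding I'_def image_image using meets_eq by (intro image_cong) auto
  then have u': "isLub UNIV ((\<lambda>A. m (r A)) ` I') u" using u by simp
  have s': "isLub UNIV ((\<lambda>A. c A (f' A)) ` I') (s (F f'))" for f'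
    using s F_Pi[of f'] F_img[of f'] by force
  have v': "isGlb UNIV ((\<lambda>f'. s (F f')) ` (I' \<rightarrow>\<^sub>E UNIV)) v"
  proof (rule isGlbI2)
    show "isLb UNIV ((\<lambda>f'. s (F f')) ` (I' \<rightarrow>\<^sub>E UNIV)) v"
      using isGlbD2[OF v] F_Pi by (auto simp: isLb_def setge_def)
    show "Collect (isLb UNIV ((\<lambda>f'. s (F f')) ` (I' \<rightarrow>\<^sub>E UNIV))) *<= v"
    proof (rule setleI, rule ballI)
      fix w assume "w \<in> Collect (isLb UNIV ((\<lambda>f'. s (F f')) ` (I' \<rightarrow>\<^sub>E UNIV)))"
      then have w: "w \<le> s (F f')" if "f' \<in> I' \<rightarrow>\<^sub>E UNIV" for f'
        using that by (auto simp: isLb_def setge_def)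
      have "w \<le> s f" if f: "f \<in> I \<rightarrow>\<^sub>E J" for f
      proof -
        define f' where "f' = (\<lambda>A\<in>I'. a (r A) (f (r A)))"
        have cf: "c A (f' A) = a (r A) (f (r A))" if "A \<in> I'" for A
        proof -
          have "a (r A) (f (r A)) \<in> R (r A)"
            using f r[OF that] by (auto simp: R_def)
          then show ?thesis using that r[OF that] by (simp add: c_def f'_def)
        qed
        have "isUb UNIV ((\<lambda>A. c A (f' A)) ` I') (s f)"
          using cf r isLubD2[OF bspec[OF s f]] by (intro isUb_UNIV_I) auto
        then have "s (F f') \<le> s f" by (rule isLub_le_isUb[OF s'])
        moreover have "w \<le> s (F f')" by (rule w) (simp add: f'_def)
        ultimately show ?thesis by (rule order_trans[rotated])
      qed
      then have "isLb UNIV (s ` (I \<rightarrow>\<^sub>E J)) w" by (auto simp: isLb_def setge_def)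
      then show "w \<le> v" by (rule isGlb_le_isLb[OF v])
    qed
  qed
  have "I' \<noteq> {}" using ne by (simp add: I'_def)
  then have "family_distributes I' UNIV c"
    using cd unfolding completely_distributive_def by blast
  then have "(\<forall>A\<in>I'. isGlb UNIV (range (c A)) (m (r A))) \<longrightarrow>
      isLub UNIV ((\<lambda>A. m (r A)) ` I') u \<longrightarrow>
      (\<forall>f'\<in>I' \<rightarrow>\<^sub>E UNIV. isLub UNIV ((\<lambda>A. c A (f' A)) ` I') (s (F f'))) \<longrightarrow>
      isGlb UNIV ((\<lambda>f'. s (F f')) ` (I' \<rightarrow>\<^sub>E UNIV)) v \<longrightarrow> u = v"
    unfolding family_distributes_def
    by (elim allE[of _ "\<lambda>A. m (r A)"] allE[of _ u] allE[of _ "\<lambda>f'. s (F f')"] allE[of _ v])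
  then show "u = v"
    using m' u' s' v' by simp
qed

end

theory Submission
  imports Defs
begin

text \<open>
  An ideal \<open>M\<close> is special exactly when some element \<open>y \<notin> M\<close> makes \<open>M\<close> the largest ideal avoiding
  \<open>y\<close>: every ideal avoiding \<open>y\<close> lies in a value of \<open>y\<close> by Zorn's lemma, so a unique value of \<open>y\<close>
  lies above all of them. This pair \<open>(M, y)\<close> splits the lattice of ideals: an ideal either contains
  \<open>y\<close> or is below \<open>M\<close>. The implications out of and into the condition on regular ideals rest on this
  dichotomy.

  If every value is special, the failure of complete distributivity for one family would be
  witnessed by an element \<open>x\<close> of the meet of joins that is outside the join of meets. Enlarge that
  join to a value \<open>M\<close> of \<open>x\<close> and split by \<open>(M, y)\<close>. The meet of each row is below \<open>M\<close>, so it avoids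
  \<open>y\<close>, so one entry of the row avoids \<open>y\<close> and is below \<open>M\<close>. Choosing these entries gives a join
  below \<open>M\<close> although it should contain \<open>x\<close>.

  Complete distributivity gives the dual infinite distributive law as the case of two rows, one of
  them constant.

  Finally, let \<open>M\<close> be a value of \<open>x\<close> and apply the dual law to \<open>M\<close> and the family of all ideals
  \<open>J\<close> not below \<open>M\<close>. Each \<open>M \<squnion> J\<close> properly extends \<open>M\<close>, so it contains \<open>x\<close>. By the law \<open>x\<close> lies
  in the join of \<open>M\<close> and the intersection of these \<open>J\<close>, so that intersection is not below \<open>M\<close>, and
  any of its elements outside \<open>M\<close> has \<open>M\<close> as the largest ideal avoiding it.
\<close>

lemma in_elements_Inf_iff: "x \<in> elements (Inf F) \<longleftrightarrow> (\<forall>I\<in>F. x \<in> elements I)"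
  by transfer auto

lemma in_elements_if_le: "x \<in> elements I \<Longrightarrow> I \<le> J \<Longrightarrow> x \<in> elements J"
  by transfer blast

lemma not_le_idealE:
  assumes "\<not> I \<le> J"
  obtains x where "x \<in> elements I" "x \<notin> elements J"
  using assms by transfer blast

lemma bot_less_if_notin_ideal: "x \<notin> elements I \<Longrightarrow> bot < x"
  using is_ideal_bot[of "elements I"] elements[of I] by (auto simp: bot.not_eq_extremum[symmetric])

lemma is_ideal_Union_chain:
  assumes "subset.chain {I. is_ideal I} C" "C \<noteq> {}"
  shows "is_ideal (\<Union>C)"
  unfolding is_ideal_def
proof (intro conjI ballI allI impI)
  have ideals: "\<And>I. I \<in> C \<Longrightarrow> is_ideal I"
    and chain: "\<And>I J. I \<in> C \<Longrightarrow> J \<in> C \<Longrightarrow> I \<subseteq> J \<or> J \<subseteq> I"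
    using assms(1) by (auto simp: subset_chain_def)
  show "\<Union>C \<noteq> {}"
    using assms(2) ideals is_ideal_bot by blast
  show "sup a b \<in> \<Union>C" if "a \<in> \<Union>C" "b \<in> \<Union>C" for a b
  proof -
    from that obtain I J where IJ: "I \<in> C" "a \<in> I" "J \<in> C" "b \<in> J"
      by blast
    show ?thesis
    proof (cases "I \<subseteq> J")
      case True
      then have "sup a b \<in> J" using IJ ideals is_ideal_sup_closed by blast
      then show ?thesis using IJ by blast
    next
      case False
      then have "sup a b \<in> I" using IJ chain ideals is_ideal_sup_closed by blast
      then show ?thesis using IJ by blast
    qed
  qed
  show "b \<in> \<Union>C" if "a \<in> \<Union>C" "b \<le> a" for a b
    using that ideals unfolding is_ideal_def by (meson UnionE UnionI)
qed

text \<open>Avoiding a fixed element survives unions of chains of ideals, so Zorn's lemma applies.\<close>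

lemma ideal_extends_to_value:
  assumes "x \<notin> elements K"
  obtains M where "is_value M x" "K \<le> M"
proof -
  let ?A = "{I. is_ideal I \<and> x \<notin> I \<and> elements K \<subseteq> I}"
  have "?A \<noteq> {}"
    using assms elements[of K] by auto
  moreover have "\<Union>C \<in> ?A" if "C \<noteq> {}" "subset.chain ?A C" for C
  proof -
    have "subset.chain {I. is_ideal I} C"
      using that(2) by (auto simp: subset_chain_def)
    then have "is_ideal (\<Union>C)"
      using is_ideal_Union_chain that(1) by blast
    then show ?thesis
      using that by (auto simp: subset_chain_def)
  qed
  ultimately have "\<exists>S\<in>?A. \<forall>X\<in>?A. S \<subseteq> X \<longrightarrow> X = S"
    by (rule subset_Zorn_nonempty)
  then obtain S where S: "S \<in> ?A" and S_max: "\<And>X. X \<in> ?A \<Longrightarrow> S \<subseteq> X \<Longrightarrow> X = S"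
    by meson
  define M where "M = Abs_ideal S"
  have M: "elements M = S"
    using S by (simp add: M_def Abs_ideal_inverse)
  have "N = M" if "x \<notin> elements N" "M \<le> N" for N
  proof -
    have "S \<subseteq> elements N"
      using that(2) M by (simp add: less_eq_ideal.rep_eq)
    then have "elements N = S"
      using S_max[of "elements N"] S that(1) elements[of N] by auto
    then show ?thesis using M by (simp add: elements_inject[symmetric])
  qed
  then have "is_value M x"
    using S M by (simp add: is_value_def)
  moreover have "K \<le> M"
    using S M by (simp add: less_eq_ideal.rep_eq)
  ultimately show ?thesis by (rule that)
qed

lemma special_ideals_subset_regular_ideals: "special_ideals \<subseteq> regular_ideals"
  by (auto simp: special_ideals_def regular_ideals_def)

text \<open>
  By Zorn's lemma every ideal avoiding \<open>y\<close> lies below some value of \<open>y\<close>, hence below the only one.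
  In this form neither maximality nor uniqueness of values has to be handled again.
\<close>

lemma special_ideal_iff_greatest_avoiding:
  "M \<in> special_ideals \<longleftrightarrow>
     (\<exists>y. y \<notin> elements M \<and> (\<forall>N. y \<notin> elements N \<longrightarrow> N \<le> M))"
proof
  assume "M \<in> special_ideals"
  then obtain y where y: "is_value M y" "\<And>N. is_value N y \<Longrightarrow> N = M"
    by (auto simp: special_ideals_def)
  have "N \<le> M" if "y \<notin> elements N" for N
    using ideal_extends_to_value[OF that] y(2) by blast
  then show "\<exists>y. y \<notin> elements M \<and> (\<forall>N. y \<notin> elements N \<longrightarrow> N \<le> M)"
    using y(1) by (auto simp: is_value_def)
next
  assume "\<exists>y. y \<notin> elements M \<and> (\<forall>N. y \<notin> elements N \<longrightarrow> N \<le> M)"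
  then obtain y where y: "y \<notin> elements M" "\<And>N. y \<notin> elements N \<Longrightarrow> N \<le> M"
    by blast
  have "is_value M y"
    unfolding is_value_def using y by (meson order_antisym)
  moreover have "N = M" if "is_value N y" for N
    using that y unfolding is_value_def by metis
  ultimately show "M \<in> special_ideals"
    unfolding special_ideals_def using bot_less_if_notin_ideal[OF y(1)] by blast
qed

lemma isGlb_UNIV_iff_Inf: "isGlb UNIV S m \<longleftrightarrow> m = Inf S" for m :: "'d::complete_lattice"
proof
  assume m: "isGlb UNIV S m"
  show "m = Inf S"
  proof (rule order_antisym)
    show "m \<le> Inf S"
      using isGlbD2[OF m] by (auto intro: Inf_greatest)
    have "isLb UNIV S (Inf S)"
      by (auto simp: isLb_def setge_def Inf_lower)
    then show "Inf S \<le> m"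
      by (rule isGlb_le_isLb[OF m])
  qed
next
  show "m = Inf S \<Longrightarrow> isGlb UNIV S m"
    by (auto simp: isGlb_def greatestP_def isLb_def setge_def setle_def
        intro: Inf_lower Inf_greatest)
qed

lemma isLub_UNIV_iff_Sup: "isLub UNIV S u \<longleftrightarrow> u = Sup S" for u :: "'d::complete_lattice"
proof
  assume u: "isLub UNIV S u"
  show "u = Sup S"
  proof (rule order_antisym)
    show "Sup S \<le> u"
      using isLubD2[OF u] by (auto intro: Sup_least)
    have "isUb UNIV S (Sup S)"
      by (auto simp: isUb_def setle_def Sup_upper)
    then show "u \<le> Sup S"
      by (rule isLub_le_isUb[OF u])
  qed
next
  show "u = Sup S \<Longrightarrow> isLub UNIV S u"
    by (auto simp: isLub_def leastP_def isUb_def setge_def setle_def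
        intro: Sup_upper Sup_least)
qed

lemma family_distributes_complete_iff:
  fixes a :: "'i \<Rightarrow> 'j \<Rightarrow> 'd::complete_lattice"
  shows "family_distributes I J a \<longleftrightarrow>
    (SUP i\<in>I. INF j\<in>J. a i j) = (INF f\<in>I \<rightarrow>\<^sub>E J. SUP i\<in>I. a i (f i))" (is "?L \<longleftrightarrow> ?R")
proof
  assume ?L
  then show ?R
    unfolding family_distributes_def isGlb_UNIV_iff_Inf isLub_UNIV_iff_Sup
    by (elim allE[of _ "\<lambda>i. INF j\<in>J. a i j"] allE[of _ "\<lambda>f. SUP i\<in>I. a i (f i)"] allE) auto
next
  assume R: ?R
  show ?L
    unfolding family_distributes_def isGlb_UNIV_iff_Inf isLub_UNIV_iff_Sup
  proof (intro allI impI)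
    fix m u s v
    assume m: "\<forall>i\<in>I. m i = (INF j\<in>J. a i j)" and u: "u = Sup (m ` I)"
      and s: "\<forall>f\<in>I \<rightarrow>\<^sub>E J. s f = (SUP i\<in>I. a i (f i))" and v: "v = Inf (s ` (I \<rightarrow>\<^sub>E J))"
    have "m ` I = (\<lambda>i. INF j\<in>J. a i j) ` I"
      using m by (intro image_cong) auto
    moreover have "s ` (I \<rightarrow>\<^sub>E J) = (\<lambda>f. SUP i\<in>I. a i (f i)) ` (I \<rightarrow>\<^sub>E J)"
      using s by (intro image_cong) auto
    ultimately show "u = v" using R u v by simp
  qed
qed

lemma SUP_INF_le_INF_SUP_PiE:
  fixes a :: "'i \<Rightarrow> 'j \<Rightarrow> 'd::complete_lattice"
  shows "(SUP i\<in>I. INF j\<in>J. a i j) \<le> (INF f\<in>I \<rightarrow>\<^sub>E J. SUP i\<in>I. a i (f i))"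
  by (intro SUP_least INF_greatest) (auto intro!: INF_lower2 SUP_upper2)

text \<open>
  An element \<open>x\<close> in the difference of the two sides would lie outside some value \<open>M\<close> above the
  join of meets; the splitting pair of \<open>M\<close> selects in each row an entry below \<open>M\<close>, which keeps the
  meet of joins below \<open>M\<close> as well.
\<close>

lemma family_distributes_if_regular_special:
  fixes a :: "'i \<Rightarrow> 'j \<Rightarrow> 'a::decomposable_lattice ideal"
  assumes "(regular_ideals :: 'a ideal set) \<subseteq> special_ideals"
  shows "family_distributes I J a"
  unfolding family_distributes_complete_iff
proof (rule order_antisym[OF SUP_INF_le_INF_SUP_PiE], rule ccontr)
  let ?u = "SUP i\<in>I. INF j\<in>J. a i j"
  let ?v = "INF f\<in>I \<rightarrow>\<^sub>E J. SUP i\<in>I. a i (f i)"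
  assume "\<not> ?v \<le> ?u"
  then obtain x where x: "x \<in> elements ?v" "x \<notin> elements ?u"
    by (rule not_le_idealE)
  obtain M where M: "is_value M x" "?u \<le> M"
    using x(2) by (rule ideal_extends_to_value)
  have "M \<in> regular_ideals"
    using M(1) bot_less_if_notin_ideal[OF x(2)] by (auto simp: regular_ideals_def)
  then obtain y where y: "y \<notin> elements M" "\<And>N. y \<notin> elements N \<Longrightarrow> N \<le> M"
    using assms special_ideal_iff_greatest_avoiding by (metis subsetD)
  have "\<exists>j\<in>J. a i j \<le> M" if "i \<in> I" for i
  proof -
    have "(INF j\<in>J. a i j) \<le> M"
      using that M(2) by (auto intro: order_trans[OF SUP_upper])
    then have "y \<notin> elements (INF j\<in>J. a i j)"
      using y(1) in_elements_if_le by blast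
    then show ?thesis
      using y(2) by (auto simp: in_elements_Inf_iff)
  qed
  then obtain g where g: "\<And>i. i \<in> I \<Longrightarrow> g i \<in> J \<and> a i (g i) \<le> M"
    by metis
  have "?v \<le> (SUP i\<in>I. a i (restrict g I i))"
    using g by (intro INF_lower) auto
  also have "\<dots> \<le> M"
    using g by (auto intro: SUP_least)
  finally have "x \<in> elements M"
    using x(1) in_elements_if_le by blast
  then show False
    using M(1) by (simp add: is_value_def)
qed

text \<open>
  Use two rows indexed by the truth values, \<open>True\<close> for the row constantly \<open>I\<close> and \<open>False\<close> for the
  row listing \<open>F\<close>; a choice function then matters only through its value at \<open>False\<close>.
\<close>

lemma sup_Inf_if_completely_distributive:
  fixes b :: "'d::complete_lattice"
  assumes "completely_distributive TYPE('d)" "F \<noteq> {}"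
  shows "sup b (Inf F) = (INF c\<in>F. sup b c)"
proof (rule order_antisym)
  show "sup b (Inf F) \<le> (INF c\<in>F. sup b c)"
    by (intro INF_greatest sup_mono order_refl Inf_lower)
  let ?a = "\<lambda>(i::bool) c. if i then b else c"
  have "family_distributes UNIV F ?a"
    using completely_distributive_family[OF assms(1) UNIV_not_empty assms(2)] .
  then have "(SUP i. INF c\<in>F. ?a i c) = (INF f\<in>UNIV \<rightarrow>\<^sub>E F. SUP i. ?a i (f i))"
    by (simp only: family_distributes_complete_iff)
  moreover have "(SUP i. INF c\<in>F. ?a i c) = sup b (Inf F)"
    using assms(2) by (simp add: UNIV_bool sup_commute)
  moreover have "(INF c\<in>F. sup b c) \<le> (INF f\<in>UNIV \<rightarrow>\<^sub>E F. SUP i. ?a i (f i))"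
  proof (rule INF_greatest)
    fix f :: "bool \<Rightarrow> 'd"
    assume "f \<in> UNIV \<rightarrow>\<^sub>E F"
    then have "f False \<in> F" by auto
    then have "(INF c\<in>F. sup b c) \<le> sup b (f False)" by (rule INF_lower)
    then show "(INF c\<in>F. sup b c) \<le> (SUP i. ?a i (f i))"
      by (simp add: UNIV_bool sup_commute)
  qed
  ultimately show "(INF c\<in>F. sup b c) \<le> sup b (Inf F)" by simp
qed

text \<open>
  A suitable \<open>y\<close> has to lie in every ideal not below \<open>M\<close> but not in \<open>M\<close>. The distributive law
  provides one: it shows that the intersection of all ideals not below \<open>M\<close> is itself not below \<open>M\<close>.
\<close>

lemma special_if_value_if_sup_Inf:
  fixes M :: "'a::decomposable_lattice ideal"
  assumes law: "\<And>F. F \<noteq> {} \<Longrightarrow> sup M (Inf F) = (INF J\<in>F. sup M J)"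
    and value_M: "is_value M x"
  shows "M \<in> special_ideals"
proof -
  let ?F = "{J. \<not> J \<le> M}"
  have "top \<in> ?F"
    using value_M by (auto simp: is_value_def less_eq_ideal.rep_eq top_ideal.rep_eq)
  then have "sup M (Inf ?F) = (INF J\<in>?F. sup M J)"
    by (intro law) blast
  moreover have "x \<in> elements (sup M J)" if "\<not> J \<le> M" for J
  proof -
    have "sup M J \<noteq> M"
      using that by (metis sup_ge2)
    then show ?thesis
      using value_M sup_ge1[of M J] by (auto simp: is_value_def)
  qed
  ultimately have "x \<in> elements (sup M (Inf ?F))"
    by (simp add: in_elements_Inf_iff)
  then have "\<not> Inf ?F \<le> M"
    using value_M by (auto simp: is_value_def sup_absorb1)
  then obtain y where y: "y \<in> elements (Inf ?F)" "y \<notin> elements M"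
    by (rule not_le_idealE)
  then have "N \<le> M" if "y \<notin> elements N" for N
    using that by (auto simp: in_elements_Inf_iff)
  then show ?thesis
    using y(2) by (auto simp: special_ideal_iff_greatest_avoiding)
qed

theorem theorem5p6:
  shows "((regular_ideals :: 'a::decomposable_lattice ideal set) = special_ideals
      \<longleftrightarrow> completely_distributive TYPE('a ideal)) \<and>
    (completely_distributive TYPE('a ideal)
      \<longleftrightarrow> (\<forall>(I :: 'a ideal) (F :: 'a ideal set). F \<noteq> {} \<longrightarrow>
            sup I (Inf F) = (INF J\<in>F. sup I J)))"
    (is "(?regular_special \<longleftrightarrow> ?distributive) \<and> (_ \<longleftrightarrow> ?dual_law)")
proof -
  have "?distributive" if "?regular_special"
    unfolding completely_distributive_def
    using family_distributes_if_regular_special that by blast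
  moreover have "?dual_law" if "?distributive"
    using sup_Inf_if_completely_distributive[OF that] by blast
  moreover have "?regular_special" if "?dual_law"
  proof
    show "regular_ideals \<subseteq> (special_ideals :: 'a ideal set)"
      unfolding regular_ideals_def using special_if_value_if_sup_Inf that by blast
  qed (rule special_ideals_subset_regular_ideals)
  ultimately show ?thesis by blast
qed

end
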